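(* Let $\mathbf B=(B,\leq,{}',0,1)$ be a Boolean poset. Then $\mathbf B$ is a generalized orthomodular poset.
   Context: For a poset $(P,\leq)$ and $A\subseteq P$ put $L(A)=\{x\in P\mid x\leq y\text{ for all }y\in A\}$ and $U(A)=\{x\in P\mid y\leq x\text{ for all }y\in A\}$; for elements or subsets separated by commas one takes the union, e.g. $L(a,b)=L(\{a,b\})$, $L(A,b)=L(A\cup\{b\})$, $U(A,B)=U(A\cup B)$, and $LU(A)=L(U(A))$. A poset is distributive if $L(U(x,y),z)=LU(L(x,z),L(y,z))$ for all $x,y,z$. In a bounded poset, $b$ is a complement of $a$ if $L(a,b)=\{0\}$ and $U(a,b)=\{1\}$; a unary operation $'$ is a complementation if $x'$ is a complement of $x$ for every $x$. A Boolean poset is a bounded distributive poset $(B,\leq,{}',0,1)$ where $'$ is a complementation. A generalized orthomodular poset is a bounded poset $(P,\leq,{}',0,1)$ with an antitone involution $'$ (i.e. $x\leq y$ implies $y'\leq x'$, and $x''=x$) that is a complementation and satisfies: $x\leq y$ implies $U(y)=U(x,L(y,x'))$. *)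

theory Defs
  imports "HOL-Algebra.Order"
begin

text \<open>
  Posets are the partial orders of HOL-Algebra, with an explicit carrier; the cones \<open>L(A)\<close> and
  \<open>U(A)\<close> are \<^const>\<open>Lower\<close> and \<^const>\<open>Upper\<close>. Commas between arguments of cones become unions,
  so that \<open>L(U(x,y),z)\<close> is \<open>Lower P (Upper P {x, y} \<union> {z})\<close>.
\<close>

locale distributive_poset = partial_order P for P :: "('a, 'm) gorder_scheme" (structure) +
  assumes distributive:
    "\<lbrakk>x \<in> carrier P; y \<in> carrier P; z \<in> carrier P\<rbrakk> \<Longrightarrow>
      Lower P (Upper P {x, y} \<union> {z}) =
      Lower P (Upper P (Lower P {x, z} \<union> Lower P {y, z}))"

locale bounded_poset = partial_order P for P :: "('a, 'm) gorder_scheme" (structure) +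
  fixes zero one :: 'a
  assumes zero_least: "least P zero (carrier P)"
    and one_greatest: "greatest P one (carrier P)"
begin

definition is_complement :: "'a \<Rightarrow> 'a \<Rightarrow> bool" where
  "is_complement b a \<longleftrightarrow>
    a \<in> carrier P \<and> b \<in> carrier P \<and> Lower P {a, b} = {zero} \<and> Upper P {a, b} = {one}"

end

locale complemented_poset = bounded_poset P zero one
  for P :: "('a, 'm) gorder_scheme" (structure) and zero one and compl :: "'a \<Rightarrow> 'a" +
  assumes compl_closed: "x \<in> carrier P \<Longrightarrow> compl x \<in> carrier P"
    and compl_complement: "x \<in> carrier P \<Longrightarrow> is_complement (compl x) x"

locale boolean_poset = distributive_poset P + complemented_poset P zero one compl
  for P :: "('a, 'm) gorder_scheme" (structure) and compl and zero one

locale generalized_orthomodular_poset = complemented_poset P zero one compl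
  for P :: "('a, 'm) gorder_scheme" (structure) and compl and zero one +
  assumes compl_antitone:
      "\<lbrakk>x \<in> carrier P; y \<in> carrier P; x \<sqsubseteq> y\<rbrakk> \<Longrightarrow> compl y \<sqsubseteq> compl x"
    and compl_involution: "x \<in> carrier P \<Longrightarrow> compl (compl x) = x"
    and generalized_orthomodular:
      "\<lbrakk>x \<in> carrier P; y \<in> carrier P; x \<sqsubseteq> y\<rbrakk> \<Longrightarrow>
        Upper P {y} = Upper P ({x} \<union> Lower P {y, compl x})"

end

theory Submission
  imports Defs
begin

text \<open>
  If \<open>U(x,c) = {1}\<close>, distributivity reads \<open>L(y) = LU(L(x,y),L(c,y))\<close>, so every common upper bound
  of \<open>L(x,y)\<close> and \<open>L(c,y)\<close> lies above \<open>y\<close>. With \<open>c\<close> a complement of \<open>x\<close> this is the generalized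
  orthomodular law. When moreover \<open>L(c,y) = {0}\<close>, the element \<open>x\<close> is such an upper bound, whence
  \<open>y \<le> x\<close>; this yields the antitone involution.
\<close>

context boolean_poset
begin

lemma zero_closed: "zero \<in> carrier P"
  and zero_le: "x \<in> carrier P \<Longrightarrow> zero \<sqsubseteq> x"
  using zero_least by (auto simp: least_def Lower_def)

lemma le_one: "x \<in> carrier P \<Longrightarrow> x \<sqsubseteq> one"
  using one_greatest by (auto simp: greatest_def Upper_def)

lemma Lower_compl: "x \<in> carrier P \<Longrightarrow> Lower P {x, compl x} = {zero}"
  and Upper_compl: "x \<in> carrier P \<Longrightarrow> Upper P {x, compl x} = {one}"
  using compl_complement by (auto simp: is_complement_def)

lemma le_upper_bound_of_meets:
  assumes "x \<in> carrier P" "c \<in> carrier P" "y \<in> carrier P"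
    and "Upper P {x, c} = {one}"
    and "w \<in> Upper P (Lower P {x, y} \<union> Lower P {c, y})"
  shows "y \<sqsubseteq> w"
proof -
  \<comment> \<open>The only member of \<open>Upper P {x, c}\<close> is \<open>one\<close>, so it
    puts no constraint on \<open>y\<close>.\<close>
  have "y \<in> Lower P (Upper P {x, c} \<union> {y})"
    using assms le_one by (auto simp: Lower_def)
  then have "y \<in> Lower P (Upper P (Lower P {x, y} \<union> Lower P {c, y}))"
    unfolding distributive[OF assms(1-3)] .
  then show ?thesis
    using assms(5) by (auto simp: Lower_def Upper_def)
qed

lemma le_of_disjoint:
  assumes "x \<in> carrier P" "c \<in> carrier P" "y \<in> carrier P"
    and "Upper P {x, c} = {one}" and "Lower P {c, y} = {zero}"
  shows "y \<sqsubseteq> x"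
proof (rule le_upper_bound_of_meets[OF assms(1-4)])
  show "x \<in> Upper P (Lower P {x, y} \<union> Lower P {c, y})"
    using assms zero_le by (auto simp: Upper_def Lower_def)
qed

text \<open>Both \<open>x\<close> and \<open>compl (compl x)\<close> are complements of
  \<open>compl x\<close>; \<open>le_of_disjoint\<close> with \<open>c\<close> as
  \<open>compl x\<close> compares them in either direction.\<close>

lemma compl_compl:
  assumes "x \<in> carrier P"
  shows "compl (compl x) = x"
proof -
  have cl: "compl x \<in> carrier P" "compl (compl x) \<in> carrier P"
    using assms compl_closed by auto
  have "x \<sqsubseteq> compl (compl x)"
    using le_of_disjoint[of "compl (compl x)" "compl x" x] assms cl
      Upper_compl[of "compl x"] Lower_compl[of x]
    by (simp add: insert_commute)
  moreover have "compl (compl x) \<sqsubseteq> x"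
    using le_of_disjoint[of x "compl x" "compl (compl x)"] assms cl
      Upper_compl[of x] Lower_compl[of "compl x"]
    by simp
  ultimately show ?thesis
    using assms cl le_antisym by blast
qed

text \<open>Since \<open>x\<close> lies below \<open>y\<close>, it is disjoint from
  \<open>compl y\<close>. So \<open>le_of_disjoint\<close> applies with \<open>compl x\<close> as
  the bound and \<open>x\<close> in the role of \<open>c\<close>.\<close>

lemma compl_anti_mono:
  assumes "x \<in> carrier P" "y \<in> carrier P" "x \<sqsubseteq> y"
  shows "compl y \<sqsubseteq> compl x"
proof (rule le_of_disjoint[of "compl x" x])
  show "Upper P {compl x, x} = {one}"
    using Upper_compl[OF assms(1)] by (simp add: insert_commute)
  have "u \<sqsubseteq> y" if "u \<in> carrier P" "u \<sqsubseteq> x" for u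
    using le_trans[OF that(2) assms(3) that(1) assms(1,2)] .
  then have "Lower P {x, compl y} \<subseteq> Lower P {y, compl y}"
    using assms by (auto simp: Lower_def)
  \<comment> \<open>The inclusion alone would still allow the empty cone.\<close>
  moreover have "zero \<in> Lower P {x, compl y}"
    using assms zero_closed zero_le by (auto simp: Lower_def)
  ultimately show "Lower P {x, compl y} = {zero}"
    using Lower_compl[OF assms(2)] by auto
qed (use assms compl_closed in auto)

text \<open>From left to right, transitivity suffices, as \<open>x\<close> and
  \<open>Lower P {y, compl x}\<close> lie below \<open>y\<close>. The converse rests on
  distributivity.\<close>

lemma Upper_orthomodular:
  assumes "x \<in> carrier P" "y \<in> carrier P" "x \<sqsubseteq> y"
  shows "Upper P {y} = Upper P ({x} \<union> Lower P {y, compl x})"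
proof (intro subset_antisym subsetI)
  fix w assume "w \<in> Upper P {y}"
  then have w: "w \<in> carrier P" "y \<sqsubseteq> w"
    using assms by (auto simp: Upper_def)
  have "u \<sqsubseteq> w" if "u \<in> carrier P" "u \<sqsubseteq> y" for u
    using le_trans[OF that(2) w(2) that(1) assms(2) w(1)] .
  then show "w \<in> Upper P ({x} \<union> Lower P {y, compl x})"
    using assms w by (auto simp: Upper_def Lower_def)
next
  fix w assume "w \<in> Upper P ({x} \<union> Lower P {y, compl x})"
  then have w: "w \<in> carrier P" "x \<sqsubseteq> w" "w \<in> Upper P (Lower P {compl x, y})"
    using assms by (auto simp: Upper_def insert_commute)
  \<comment> \<open>Being above \<open>x\<close>, \<open>w\<close> also bounds
    \<open>Lower P {x, y}\<close>, the other half of what \<open>le_upper_bound_of_meets\<close>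
    asks for.\<close>
  have "u \<sqsubseteq> w" if "u \<in> carrier P" "u \<sqsubseteq> x" for u
    using le_trans[OF that(2) w(2) that(1) assms(1) w(1)] .
  then have "w \<in> Upper P (Lower P {x, y} \<union> Lower P {compl x, y})"
    using assms w by (auto simp: Upper_def Lower_def)
  then have "y \<sqsubseteq> w"
    by (rule le_upper_bound_of_meets[OF assms(1) compl_closed[OF assms(1)] assms(2)
          Upper_compl[OF assms(1)]])
  then show "w \<in> Upper P {y}"
    using w by (auto simp: Upper_def)
qed

end

theorem proposition2p3:
  fixes B :: "('a, 'm) gorder_scheme" and compl :: "'a \<Rightarrow> 'a" and zero one :: 'a
  assumes "boolean_poset B compl zero one"
  shows "generalized_orthomodular_poset B compl zero one"
proof -
  interpret boolean_poset B compl zero one by fact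
  show ?thesis
    by unfold_locales (fact compl_anti_mono compl_compl Upper_orthomodular)+
qed

end
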